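(* Let $C$ be a closed convex cone in $H$, $K$ a nonempty closed convex subset of $H$, and let $f:C\to H$ and $g:H\to H$ be weakly homogeneous mappings of degrees $\delta_1>0$ and $\delta_2>0$, respectively, with leading terms $f^\infty$ and $g^\infty$. Assume $g^{-1}(K)\subseteq C$. For $\hat x\in H$ and $r>\|\Pi_K(\hat x)\|$ put $\Omega^{\hat x}_r:=\{x\in H\mid \|g(x)\|<r\}$. Suppose that for any given $\hat x\in H$ and every $r>\|\Pi_K(\hat x)\|$ the degree $\deg(g,\Omega^{\hat x}_r,\Pi_K(\hat x))$ is defined and nonzero, and that the following conditions hold: (i) there exists some $\theta$ with $g(\theta)\in K$ such that $\langle f(x)-f(\theta),g(x)-g(\theta)\rangle\ge 0$ holds for any $x$ with $g(x)\in K$; (ii) $\langle f^\infty(x),g^\infty(x)\rangle\ne 0$ for any $x\in C$ with $\|x\|=1$ and $g^\infty(x)\in K^\infty$. Then the solution set SOL$(f,g,K)$ of WHGVI$(f,g,K)$ is nonempty and compact.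
   Context: $H$ is a finite dimensional real Hilbert space with inner product $\langle\cdot,\cdot\rangle$ and norm $\|\cdot\|$; $\Pi_K$ is the orthogonal projection onto $K$; $g^{-1}(K)=\{x\in H\mid g(x)\in K\}$. Weakly homogeneous mappings: let $D\subseteq H$ be a closed convex cone ($D=C$ for $f$, $D=H$ for $g$). A continuous $h:D\to H$ is positively homogeneous of degree $\delta$ if $h(\lambda x)=\lambda^\delta h(x)$ for all $x\in D$, $\lambda>0$. A mapping $\varphi:D\to H$ is weakly homogeneous of degree $\delta>0$ if $\varphi=h+e$ with $h$ positively homogeneous of degree $\delta$ and $e:D\to H$ continuous with $e(x)/\|x\|^\delta\to0$ as $\|x\|\to\infty$ in $D$. Then $h$ is uniquely determined; it is called the leading term of $\varphi$ and denoted $\varphi^\infty$. Recession cone: $K^\infty:=\{u\in H\mid \exists t_k\to\infty,\ \exists x^k\in K \text{ such that } x^k/t_k\to u\}$. WHGVI$(f,g,K)$ is the problem of finding $x^*\in H$ such that $g(x^* )\in K$ and $\langle f(x^* ),y-g(x^* )\rangle\ge0$ for all $y\in K$; SOL$(f,g,K)$ is the set of all its solutions. $\deg(\phi,\Omega,b)$ is the topological (Brouwer) degree; it is defined when $\Omega\subset H$ is bounded and open, $\phi:\bar\Omega\to H$ is continuous, and $b\notin\phi(\partial\Omega)$. *)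

theory Defs
  imports "HOL-Analysis.Analysis" "HOL-Homology.Homology"
begin

section \<open>Weakly homogeneous mappings\<close>

text \<open>Functions are total, but all conditions below only concern their values on \<open>D\<close>.\<close>

definition positively_homogeneous_on ::
    "'a::real_normed_vector set \<Rightarrow> real \<Rightarrow> ('a \<Rightarrow> 'a) \<Rightarrow> bool" where
  "positively_homogeneous_on D \<delta> h \<longleftrightarrow>
     continuous_on D h \<and> (\<forall>x\<in>D. \<forall>t>0. h (t *\<^sub>R x) = (t powr \<delta>) *\<^sub>R h x)"

text \<open>\<open>weakly_homogeneous_on D \<delta> \<phi> h\<close>: \<open>\<phi>\<close> is weakly homogeneous of degree \<open>\<delta>\<close> on \<open>D\<close> with
  leading term \<open>h\<close>. On a closed convex cone \<open>D\<close>, \<open>h\<close> is uniquely determined on \<open>D\<close> by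
  \<open>\<phi>\<close>.\<close>

definition weakly_homogeneous_on ::
    "'a::real_normed_vector set \<Rightarrow> real \<Rightarrow> ('a \<Rightarrow> 'a) \<Rightarrow> ('a \<Rightarrow> 'a) \<Rightarrow> bool" where
  "weakly_homogeneous_on D \<delta> \<phi> h \<longleftrightarrow>
     0 < \<delta> \<and> positively_homogeneous_on D \<delta> h \<and>
     (\<exists>e. continuous_on D e \<and> (\<forall>x\<in>D. \<phi> x = h x + e x) \<and>
          ((\<lambda>x. e x /\<^sub>R (norm x powr \<delta>)) \<longlongrightarrow> 0) (inf at_infinity (principal D)))"

section \<open>Recession cone and generalized variational inequality\<close>

definition recession_cone :: "'a::real_normed_vector set \<Rightarrow> 'a set" where
  "recession_cone K =
     {u. \<exists>t x. filterlim (t :: nat \<Rightarrow> real) at_top sequentially \<and> (\<forall>k. x k \<in> K) \<and>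
               (\<lambda>k. x k /\<^sub>R t k) \<longlonglongrightarrow> u}"

definition GVI_SOL ::
    "('a::real_inner \<Rightarrow> 'a) \<Rightarrow> ('a \<Rightarrow> 'a) \<Rightarrow> 'a set \<Rightarrow> 'a set" where
  "GVI_SOL f g K = {x. g x \<in> K \<and> (\<forall>y\<in>K. 0 \<le> f x \<bullet> (y - g x))}"

section \<open>Brouwer degree\<close>

text \<open>The triples \<open>(\<phi>, \<Omega>, b)\<close> for which the degree is defined.\<close>

definition degree_defined ::
    "('a::euclidean_space \<Rightarrow> 'a) \<Rightarrow> 'a set \<Rightarrow> 'a \<Rightarrow> bool" where
  "degree_defined \<phi> \<Omega> b \<longleftrightarrow>
     open \<Omega> \<and> bounded \<Omega> \<and> continuous_on (closure \<Omega>) \<phi> \<and> b \<notin> \<phi> ` frontier \<Omega>"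

text \<open>The homological definition of the degree (Dold, Lectures on Algebraic Topology, IV.5 and
  VIII.4). Let \<open>n\<close> be the dimension of the space \<open>H\<close> and \<open>Z = \<Omega> \<inter> \<phi>\<^sup>-\<^sup>1(b)\<close>, which is compact
  when the degree is defined. A generator \<open>a\<close> of the infinite cyclic group \<open>H\<^sub>n(H, H - B)\<close>, for a
  closed ball \<open>B\<close> containing \<open>\<Omega>\<close> and \<open>b\<close>, is an orientation; its restrictions to
  \<open>H\<^sub>n(H, H - Z)\<close> and \<open>H\<^sub>n(H, H - {b})\<close> are the fundamental classes around \<open>Z\<close> and at \<open>b\<close>.
  By excision the former comes from a unique class \<open>c\<close> in \<open>H\<^sub>n(\<Omega>, \<Omega> - Z)\<close>, and the degree is the
  integer \<open>d\<close> such that \<open>\<phi>\<close> maps \<open>c\<close> to \<open>d\<close> times the fundamental class at \<open>b\<close>.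
  Homology groups are written multiplicatively, so this multiple is a power. Replacing \<open>a\<close> by
  the other generator changes both sides, hence \<open>d\<close> does not depend on the orientation.\<close>

definition has_degree ::
    "('a::euclidean_space \<Rightarrow> 'a) \<Rightarrow> 'a set \<Rightarrow> 'a \<Rightarrow> int \<Rightarrow> bool" where
  "has_degree \<phi> \<Omega> b d \<longleftrightarrow>
    (let n = int DIM('a);
         X = (euclidean :: 'a topology);
         Z = {x \<in> \<Omega>. \<phi> x = b}
     in \<exists>R a c.
          \<Omega> \<subseteq> cball 0 R \<and> b \<in> cball 0 R \<and>
          a \<in> carrier (relative_homology_group n X (- cball 0 R)) \<and>
          subgroup_generated (relative_homology_group n X (- cball 0 R)) {a} =
            relative_homology_group n X (- cball 0 R) \<and>
          c \<in> carrier (relative_homology_group n (top_of_set \<Omega>) (\<Omega> - Z)) \<and>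
          hom_induced n (top_of_set \<Omega>) (\<Omega> - Z) X (- Z) id c =
            hom_induced n X (- cball 0 R) X (- Z) id a \<and>
          hom_induced n (top_of_set \<Omega>) (\<Omega> - Z) X (- {b}) \<phi> c =
            hom_induced n X (- cball 0 R) X (- {b}) id a
              [^]\<^bsub>relative_homology_group n X (- {b})\<^esub> d)"

definition brouwer_degree ::
    "('a::euclidean_space \<Rightarrow> 'a) \<Rightarrow> 'a set \<Rightarrow> 'a \<Rightarrow> int" where
  "brouwer_degree \<phi> \<Omega> b = (THE d. has_degree \<phi> \<Omega> b d)"

end

(* Choose theta as in (i). Evaluating the leading terms along a sequence of directions
   x_k / |x_k|, condition (i) together with the nondegeneracy (ii) gives M such that
   <f(x), g(x) - g(theta)> > 0 whenever g(x) lies in K and |x| >= M. This bounds the solution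
   set. For existence, solutions are the zeros of g(x) - P_K(g(x) - f(x)), and this map is joined
   to g - g(theta) by the homotopy g(x) - P_K(t (g(x) - f(x)) + (1 - t) g(theta)), whose zeros
   avoid the boundary of {|g| < r} for large r by the same positivity. Hence, if there were no
   solution, the degree of g at g(theta) would vanish.

   For the homological degree only this vanishing is needed: if a homotopy starting at g avoids
   b on the boundary and omits b at its end, then the fundamental class around the compact set of
   all points ever mapped to b is sent to the class induced by a map into H - {b}, which is
   trivial. As the orientation class at b has infinite order, 0 is then the only degree. *)

theory Submission
  imports Defs
begin

section \<open>Homology of complements of points and balls, and the orientation class\<close>

text \<open>Sliding points along rays from \<open>b\<close> is a linear homotopy from the identity
  to \<open>\<rho>\<close>, both inside \<open>A\<close> (by \<open>seg\<close>) and inside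
  \<open>- {b}\<close> (by \<open>pos\<close>). Hence \<open>\<rho>\<close> is a homotopy inverse of
  the inclusion.\<close>

lemma iso_reduced_homology_radial_retract:
  fixes A :: "'a::real_normed_vector set"
  assumes "b \<notin> A" and s: "continuous_on (- {b}) s" and pos: "\<And>x. x \<noteq> b \<Longrightarrow> 0 < s x"
    and r: "\<And>x. x \<noteq> b \<Longrightarrow> b + s x *\<^sub>R (x - b) \<in> A"
    and seg: "\<And>x. x \<in> A \<Longrightarrow> closed_segment x (b + s x *\<^sub>R (x - b)) \<subseteq> A"
  shows "hom_induced p (top_of_set A) {} (top_of_set (- {b})) {} id
    \<in> iso (reduced_homology_group p (top_of_set A)) (reduced_homology_group p (top_of_set (- {b})))"
proof -
  define \<rho> where "\<rho> = (\<lambda>x. b + s x *\<^sub>R (x - b))"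
  have cont: "continuous_on (- {b}) \<rho>"
    unfolding \<rho>_def by (intro continuous_intros s)
  have A: "A \<subseteq> - {b}" using \<open>b \<notin> A\<close> by auto
  have segb: "closed_segment x (\<rho> x) \<subseteq> - {b}" if "x \<noteq> b" for x
  proof
    fix y assume "y \<in> closed_segment x (\<rho> x)"
    then obtain u where u: "0 \<le> u" "u \<le> 1" and y: "y = (1 - u) *\<^sub>R x + u *\<^sub>R \<rho> x"
      by (auto simp: closed_segment_def)
    \<comment> \<open>The factor is a convex combination of 1 and \<open>s x\<close>, so it stays
      positive and the segment misses \<open>b\<close>.\<close>
    have "y - b = ((1 - u) + u * s x) *\<^sub>R (x - b)"
      by (simp add: y \<rho>_def algebra_simps)
    moreover have "0 < (1 - u) + u * s x"
      using u pos[OF that] by (cases "u = 0") (auto intro: add_nonneg_pos)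
    ultimately show "y \<in> - {b}"
      using that by auto
  qed
  have "homotopic_with_canon (\<lambda>x. True) A A id \<rho>"
    by (rule homotopic_with_linear)
      (use seg continuous_on_subset[OF cont A] in \<open>auto simp: \<rho>_def id_def\<close>)
  moreover have "homotopic_with_canon (\<lambda>x. True) (- {b}) (- {b}) id \<rho>"
    by (rule homotopic_with_linear) (use segb cont in \<open>auto simp: id_def\<close>)
  ultimately show ?thesis
    by (intro homotopy_equivalence_reduced_homology_group_isomorphism[where g=\<rho>])
      (use A cont r continuous_on_subset[OF cont A] in
       \<open>auto simp: homotopic_with_sym \<rho>_def continuous_map_subtopology_eu\<close>)
qed

text \<open>Points are pushed radially from \<open>b\<close>, which need not be the centre of the
  ball, onto a sphere around \<open>b\<close> that encloses the ball.\<close>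

lemma iso_reduced_homology_cball_complement:
  fixes b :: "'a::real_normed_vector"
  assumes "b \<in> cball 0 R"
  shows "hom_induced p (top_of_set (- cball 0 R)) {} (top_of_set (- {b})) {} id
    \<in> iso (reduced_homology_group p (top_of_set (- cball 0 R)))
          (reduced_homology_group p (top_of_set (- {b})))"
proof -
  \<comment> \<open>Points at distance at least \<open>S\<close> from \<open>b\<close> have norm at
    least \<open>R + 1\<close>, so they lie outside the ball.\<close>
  define S where "S = R + norm b + 1"
  have S: "0 < S" and b: "norm b \<le> R"
    using assms norm_ge_zero[of b] unfolding S_def by (auto simp del: norm_ge_zero)
  show ?thesis
  proof (rule iso_reduced_homology_radial_retract[where s = "\<lambda>x. S / norm (x - b)"])
    have far: "b + v \<notin> cball 0 R" if "S \<le> norm v" for v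
      using that norm_triangle_ineq2[of v "- b"] by (auto simp: S_def add.commute)
    show "b \<notin> - cball 0 R" using assms by simp
    show "continuous_on (- {b}) (\<lambda>x. S / norm (x - b))"
      by (intro continuous_intros) auto
    show "0 < S / norm (x - b)" if "x \<noteq> b" for x
      using S that by simp
    show "b + (S / norm (x - b)) *\<^sub>R (x - b) \<in> - cball 0 R" if "x \<noteq> b" for x
      using far[of "(S / norm (x - b)) *\<^sub>R (x - b)"] S that by auto
    show "closed_segment x (b + (S / norm (x - b)) *\<^sub>R (x - b)) \<subseteq> - cball 0 R"
      if x: "x \<in> - cball 0 R" for x
    proof
      fix y assume "y \<in> closed_segment x (b + (S / norm (x - b)) *\<^sub>R (x - b))"
      then obtain u where u: "0 \<le> u" "u \<le> 1"
        and y: "y = (1 - u) *\<^sub>R x + u *\<^sub>R (b + (S / norm (x - b)) *\<^sub>R (x - b))"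
        by (auto simp: closed_segment_def)
      \<comment> \<open>\<open>l\<close> is the position of \<open>y\<close> on the ray from
        \<open>b\<close> through \<open>x\<close>. If \<open>l\<close> is at least 1, then
        \<open>x\<close> lies between \<open>b\<close> and \<open>y\<close>, and convexity of the
        ball keeps \<open>y\<close> outside. Otherwise the motion is inward and stops at distance
        \<open>S\<close>, which is far enough.\<close>
      define l where "l = (1 - u) + u * (S / norm (x - b))"
      have yl: "y = b + l *\<^sub>R (x - b)"
        by (simp add: y l_def algebra_simps)
      have nz: "0 < norm (x - b)" using x assms by auto
      show "y \<in> - cball 0 R"
      proof (cases "l \<ge> 1")
        case True
        have "x = (1 - 1 / l) *\<^sub>R b + (1 / l) *\<^sub>R y"
          using True by (simp add: yl algebra_simps)
        then have "x \<in> closed_segment b y"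
          unfolding closed_segment_def using True by (auto intro!: exI[of _ "1 / l"])
        then have "y \<in> cball 0 R \<Longrightarrow> x \<in> cball 0 R"
          using closed_segment_subset[OF assms _ convex_cball] by blast
        then show ?thesis using x by blast
      next
        case False
        have "S / norm (x - b) \<le> 1"
        proof (rule ccontr)
          assume "\<not> ?thesis"
          then have "u * 1 \<le> u * (S / norm (x - b))"
            using u by (intro mult_left_mono) auto
          then show False using False by (simp add: l_def)
        qed
        then have "(1 - u) * (S / norm (x - b)) \<le> (1 - u) * 1"
          using u by (intro mult_left_mono) auto
        moreover have "(1 - u) * q + u * q = q" for q :: real
          by (simp add: algebra_simps)
        ultimately have "S / norm (x - b) \<le> l"
          unfolding l_def by (smt (verit))
        then have "S \<le> l * norm (x - b)"
          using nz by (simp add: field_simps)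
        moreover have "0 \<le> l"
          unfolding l_def using u S nz by simp
        ultimately show ?thesis
          using far[of "l *\<^sub>R (x - b)"] yl by simp
      qed
    qed
  qed
qed

lemma iso_reduced_homology_sphere:
  "hom_induced p (top_of_set (sphere 0 1)) {} (top_of_set (- {0})) {} id
    \<in> iso (reduced_homology_group p (top_of_set (sphere (0::'a::real_normed_vector) 1)))
          (reduced_homology_group p (top_of_set (- {0})))"
  by (rule iso_reduced_homology_radial_retract[where s = "\<lambda>x. 1 / norm x"])
    (auto intro!: continuous_intros)

text \<open>The orthonormal \<open>Basis\<close> identifies the unit sphere with
  \<open>nsphere\<close>, whose reduced homology is known.\<close>

lemma reduced_homology_group_sphere:
  "reduced_homology_group (int (DIM('a) - 1)) (top_of_set (sphere (0::'a::euclidean_space) 1))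
    \<cong> integer_group"
proof -
  obtain h :: "(nat \<Rightarrow> real) \<Rightarrow> 'a" and k
    where "homeomorphic_maps (nsphere (DIM('a) - 1)) (top_of_set (sphere 0 1 \<inter> span Basis)) h k"
    using homeomorphic_maps_nsphere_euclidean_sphere[OF independent_Basis orthogonal_Basis refl, where ?'n='a]
    by (metis DIM_ge_Suc0 not_less_eq_eq le0 norm_Basis)
  then have "top_of_set (sphere (0::'a) 1) homeomorphic_space nsphere (DIM('a) - 1)"
    by (metis Int_UNIV_right homeomorphic_maps_imp_homeomorphic_space homeomorphic_space_sym span_Basis)
  then show ?thesis
    using homeomorphic_space_imp_isomorphic_reduced_homology_groups reduced_homology_group_nsphere(1)
      iso_trans by blast
qed

text \<open>The ambient space is contractible, so its reduced homology vanishes and the long exact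
  sequence of the pair makes the boundary map an isomorphism.\<close>

lemma iso_hom_boundary_cball_complement:
  "hom_boundary n euclidean (- cball 0 R)
    \<in> iso (relative_homology_group n euclidean (- cball (0::'a::euclidean_space) R))
          (reduced_homology_group (n - 1) (top_of_set (- cball 0 R)))"
proof -
  have "- cball (0::'a) R \<noteq> {}"
    using cobounded_imp_unbounded[of "cball (0::'a) R"] by auto
  moreover have "contractible_space (euclidean :: 'a topology)"
    by (metis contractible_UNIV contractible_space_top_of_set subtopology_UNIV)
  ultimately show ?thesis
    using iso_relative_homology_of_contractible[of euclidean "- cball (0::'a) R" n] by simp
qed

text \<open>Boundary map, radial retraction and the sphere computation are chained. This supplies a
  generator as orientation class and shows that it has infinite order.\<close>

lemma relative_homology_group_cball_complement:
  assumes "0 \<le> R"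
  shows "relative_homology_group (int DIM('a)) euclidean (- cball (0::'a::euclidean_space) R)
    \<cong> integer_group"
proof -
  \<comment> \<open>The dimension is at least 1, so the truncated subtraction on naturals agrees
    with the integer one.\<close>
  have DIM: "int DIM('a) - 1 = int (DIM('a) - 1)"
    by (metis DIM_ge_Suc0 One_nat_def of_nat_1 of_nat_diff)
  have "relative_homology_group (int DIM('a)) euclidean (- cball (0::'a) R)
      \<cong> reduced_homology_group (int (DIM('a) - 1)) (top_of_set (- cball (0::'a) R))"
    using is_isoI[OF iso_hom_boundary_cball_complement[where n = "int DIM('a)"]] unfolding DIM .
  also have "\<dots> \<cong> reduced_homology_group (int (DIM('a) - 1)) (top_of_set (- {0::'a}))"
    using iso_reduced_homology_cball_complement[of "0::'a" R] assms by (meson centre_in_cball is_isoI)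
  also have "\<dots> \<cong> reduced_homology_group (int (DIM('a) - 1)) (top_of_set (sphere (0::'a) 1))"
    using iso_reduced_homology_sphere by (metis group.iso_sym group_reduced_homology_group is_isoI)
  also have "\<dots> \<cong> integer_group"
    by (rule reduced_homology_group_sphere)
  finally show ?thesis .
qed

text \<open>By naturality of the boundary, this map followed by \<open>?e\<close> equals
  \<open>?r \<circ> ?d\<close>, a composite of isomorphisms. Thus the orientation class keeps
  infinite order when restricted to \<open>b\<close>.\<close>

lemma inj_on_hom_induced_cball_complement:
  fixes b :: "'a::euclidean_space"
  assumes "b \<in> cball 0 R"
  shows "inj_on (hom_induced n euclidean (- cball 0 R) euclidean (- {b}) id)
    (carrier (relative_homology_group n euclidean (- cball 0 R)))" (is "inj_on ?h (carrier ?G)")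
proof -
  let ?d = "hom_boundary n euclidean (- cball (0::'a) R)"
  let ?e = "hom_boundary n euclidean (- {b})"
  let ?r = "hom_induced (n - 1) (top_of_set (- cball 0 R)) {} (top_of_set (- {b})) {} id"
  have "?e \<circ> ?h = ?r \<circ> ?d"
    by (rule naturality_hom_induced) (use assms in auto)
  moreover have "?d \<in> iso ?G (reduced_homology_group (n - 1) (top_of_set (- cball 0 R)))"
    by (rule iso_hom_boundary_cball_complement)
  then have "inj_on (?r \<circ> ?d) (carrier ?G)"
    using iso_reduced_homology_cball_complement[OF assms, of "n - 1"]
    by (auto simp: iso_def bij_betw_def intro!: comp_inj_on)
  ultimately show ?thesis
    by (metis inj_on_imageI2)
qed

text \<open>Excision of the closed set \<open>- \<Omega>\<close>, which lies in the open set
  \<open>- W\<close>.\<close>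

lemma iso_relative_homology_neighbourhood:
  fixes \<Omega> W :: "'a::topological_space set"
  assumes "open \<Omega>" "closed W" "W \<subseteq> \<Omega>"
  shows "hom_induced n (top_of_set \<Omega>) (\<Omega> - W) euclidean (- W) id
    \<in> iso (relative_homology_group n (top_of_set \<Omega>) (\<Omega> - W))
          (relative_homology_group n euclidean (- W))"
proof -
  have "euclidean closure_of (- \<Omega>) \<subseteq> euclidean interior_of (- W)"
    using assms by (simp add: closed_Compl open_Compl interior_open)
  from homology_excision_axiom[OF this subset_UNIV, of n] show ?thesis
    using \<open>W \<subseteq> \<Omega>\<close> by (simp add: Diff_eq Int_commute)
qed

section \<open>Vanishing of the homological degree\<close>

text \<open>As \<open>brouwer_degree\<close> is a definite description, two facts are needed: every
  admissible \<open>d\<close> is 0 (\<open>degree_0\<close>), and 0 is admissible. Both rest on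
  \<open>g_class\<close>.\<close>

lemma brouwer_degree_eq_0_homotopy:
  fixes g :: "'a::euclidean_space \<Rightarrow> 'a" and H :: "real \<times> 'a \<Rightarrow> 'a"
  assumes def: "degree_defined g \<Omega> b"
    and H: "continuous_on ({0..1} \<times> closure \<Omega>) H"
    and H0: "\<And>x. x \<in> \<Omega> \<Longrightarrow> H (0, x) = g x"
    and frontier: "\<And>t x. t \<in> {0..1} \<Longrightarrow> x \<in> frontier \<Omega> \<Longrightarrow> H (t, x) \<noteq> b"
    and H1: "\<And>x. x \<in> \<Omega> \<Longrightarrow> H (1, x) \<noteq> b"
  shows "brouwer_degree g \<Omega> b = 0"
proof -
  define n where "n = int DIM('a)"
  define X where "X = (euclidean :: 'a topology)"
  define Y where "Y = top_of_set \<Omega>"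
  define Z where "Z = {x \<in> \<Omega>. g x = b}"
  \<comment> \<open>Working over \<open>W\<close> instead of \<open>Z\<close> makes every stage of the homotopy a map of pairs
    from \<open>(\<Omega>, \<Omega> - W)\<close> to \<open>(X, - {b})\<close>.\<close>
  define W where "W = {x \<in> \<Omega>. \<exists>t\<in>{0..1}. H (t, x) = b}"
  have "open \<Omega>" "bounded \<Omega>" and g: "continuous_on (closure \<Omega>) g" and gf: "b \<notin> g ` frontier \<Omega>"
    using def by (auto simp: degree_defined_def)
  have frontier_eq: "frontier \<Omega> = closure \<Omega> - \<Omega>"
    using \<open>open \<Omega>\<close> by (simp add: frontier_def interior_open)
  have "compact (closure \<Omega>)" using \<open>bounded \<Omega>\<close> by simp
  \<comment> \<open>Since \<open>b\<close> is not attained on the frontier, \<open>Z\<close> is also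
    the preimage in the closure, hence closed.\<close>
  have "Z = closure \<Omega> \<inter> g -` {b}"
    using gf closure_subset[of \<Omega>] by (auto simp: Z_def frontier_eq)
  then have "closed Z"
    using continuous_closed_preimage[OF g closed_closure] by simp
  \<comment> \<open>\<open>W\<close> is the projection of a compact set; the frontier condition
    keeps that projection inside \<open>\<Omega>\<close>.\<close>
  have "W = snd ` (({0..1} \<times> closure \<Omega>) \<inter> H -` {b})"
  proof
    show "W \<subseteq> snd ` (({0..1} \<times> closure \<Omega>) \<inter> H -` {b})"
      using closure_subset[of \<Omega>] unfolding W_def by force
    show "snd ` (({0..1} \<times> closure \<Omega>) \<inter> H -` {b}) \<subseteq> W"
      using frontier unfolding W_def frontier_eq by force
  qed
  moreover have "compact (({0..1} \<times> closure \<Omega>) \<inter> H -` {b})"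
    using compact_Int_closed[OF compact_Times[OF compact_Icc[of 0 1] \<open>compact (closure \<Omega>)\<close>]
        continuous_closed_preimage[OF H closed_Times[OF closed_atLeastAtMost closed_closure]
          closed_singleton[of b]]]
    by (simp add: Int_left_absorb)
  ultimately have "closed W"
    by (simp add: compact_continuous_image compact_imp_closed continuous_on_snd)
  have "Z \<subseteq> W" using H0 by (force simp: Z_def W_def)
  have "W \<subseteq> \<Omega>" "Z \<subseteq> \<Omega>" by (auto simp: W_def Z_def)
  have isoZ: "hom_induced n Y (\<Omega> - Z) X (- Z) id
      \<in> iso (relative_homology_group n Y (\<Omega> - Z)) (relative_homology_group n X (- Z))"
    and isoW: "hom_induced n Y (\<Omega> - W) X (- W) id
      \<in> iso (relative_homology_group n Y (\<Omega> - W)) (relative_homology_group n X (- W))"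
    unfolding X_def Y_def
    by (intro iso_relative_homology_neighbourhood \<open>open \<Omega>\<close> \<open>closed Z\<close> \<open>closed W\<close> \<open>Z \<subseteq> \<Omega>\<close> \<open>W \<subseteq> \<Omega>\<close>)+
  have contH: "continuous_on \<Omega> (\<lambda>x. H (t, x))" if "t \<in> {0..1}" for t
    by (rule continuous_on_compose2[OF H]) (use that closure_subset[of \<Omega>] in \<open>auto intro!: continuous_intros\<close>)
  have homotopic: "homotopic_with (\<lambda>h. h \<in> \<Omega> - W \<rightarrow> - {b}) Y X g (\<lambda>x. H (1, x))"
  proof -
    have "homotopic_with (\<lambda>h. h \<in> \<Omega> - W \<rightarrow> - {b}) Y X (\<lambda>x. H (0, x)) (\<lambda>x. H (1, x))"
      unfolding homotopic_with_def
    proof (intro exI[of _ H] conjI)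
      show "continuous_map (prod_topology (top_of_set {0..1}) Y) X H"
        unfolding X_def Y_def using continuous_on_subset[OF H] closure_subset[of \<Omega>]
        by (simp add: Sigma_mono flip: subtopology_Times)
    qed (auto simp: W_def)
    then show ?thesis
      by (rule homotopic_with_eq) (auto simp: H0 Y_def)
  qed
  have g_class: "hom_induced n Y (\<Omega> - Z) X (- {b}) g c = \<one>\<^bsub>relative_homology_group n X (- {b})\<^esub>"
    if \<Omega>R: "\<Omega> \<subseteq> cball 0 R" and a: "a \<in> carrier (relative_homology_group n X (- cball 0 R))"
      and c: "c \<in> carrier (relative_homology_group n Y (\<Omega> - Z))"
      and ca: "hom_induced n Y (\<Omega> - Z) X (- Z) id c = hom_induced n X (- cball 0 R) X (- Z) id a"
    for R a c
  proof -
    have "hom_induced n X (- cball 0 R) X (- W) id a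
        \<in> hom_induced n Y (\<Omega> - W) X (- W) id ` carrier (relative_homology_group n Y (\<Omega> - W))"
      using isoW hom_induced_carrier[of n X "- cball 0 R" X "- W" id a] by (simp add: iso_iff)
    then obtain c' where c'a: "hom_induced n X (- cball 0 R) X (- W) id a = hom_induced n Y (\<Omega> - W) X (- W) id c'"
      and c': "c' \<in> carrier (relative_homology_group n Y (\<Omega> - W))"
      by (rule imageE)
    have injZ: "inj_on (hom_induced n Y (\<Omega> - Z) X (- Z) id) (carrier (relative_homology_group n Y (\<Omega> - Z)))"
      using isoZ by (simp add: iso_iff)
    \<comment> \<open>The class \<open>c'\<close> around \<open>W\<close> lifts the orientation. Its
      image around \<open>Z\<close> and \<open>c\<close> have the same restriction, so injectivity
      of the excision map identifies them.\<close>
    let ?c = "hom_induced n Y (\<Omega> - W) Y (\<Omega> - Z) id c'"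
    have "hom_induced n Y (\<Omega> - Z) X (- Z) id ?c = hom_induced n Y (\<Omega> - W) X (- Z) id c'"
      by (subst hom_induced_compose') (use \<open>Z \<subseteq> W\<close> in \<open>auto simp: X_def Y_def\<close>)
    also have "\<dots> = hom_induced n X (- W) X (- Z) id (hom_induced n Y (\<Omega> - W) X (- W) id c')"
      by (subst hom_induced_compose') (use \<open>Z \<subseteq> W\<close> in \<open>auto simp: X_def Y_def\<close>)
    also have "\<dots> = hom_induced n X (- cball 0 R) X (- Z) id a"
      unfolding c'a[symmetric]
      by (subst hom_induced_compose')
        (use \<open>Z \<subseteq> W\<close> \<open>W \<subseteq> \<Omega>\<close> \<Omega>R in \<open>auto simp: X_def\<close>)
    also note ca[symmetric]
    finally have "?c = c"
      by (rule inj_onD[OF injZ _ hom_induced_carrier c])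
    have contg: "continuous_map Y X g"
      using homotopic homotopic_with_imp_continuous_maps by blast
    have "hom_induced n Y (\<Omega> - Z) X (- {b}) g c = hom_induced n Y (\<Omega> - W) X (- {b}) g c'"
      unfolding \<open>?c = c\<close>[symmetric]
      by (subst hom_induced_compose') (use \<open>Z \<subseteq> W\<close> contg in \<open>auto simp: Z_def\<close>)
    also have "\<dots> = hom_induced n Y (\<Omega> - W) X (- {b}) (\<lambda>x. H (1, x)) c'"
      by (simp only: homology_homotopy_axiom[OF homotopic])
    \<comment> \<open>\<open>H (1, _)\<close> omits \<open>b\<close> on all of
      \<open>\<Omega>\<close>, so it factors through the pair of \<open>- {b}\<close> with itself,
      whose relative homology is trivial.\<close>
    also have "\<dots> = hom_induced n (top_of_set (- {b})) (- {b}) X (- {b}) id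
        (hom_induced n Y (\<Omega> - W) (top_of_set (- {b})) (- {b}) (\<lambda>x. H (1, x)) c')"
      by (subst hom_induced_compose')
        (use contH[of 1] H1 in \<open>auto simp: X_def Y_def o_def\<close>)
    also have "hom_induced n Y (\<Omega> - W) (top_of_set (- {b})) (- {b}) (\<lambda>x. H (1, x)) c'
        = \<one>\<^bsub>relative_homology_group n (top_of_set (- {b})) (- {b})\<^esub>"
      using trivial_relative_homology_group_topspace[of n "top_of_set (- {b})"]
        hom_induced_carrier[of n Y "\<Omega> - W" "top_of_set (- {b})" "- {b}" "\<lambda>x. H (1, x)" c']
      by (simp add: trivial_group_def)
    also have "hom_induced n (top_of_set (- {b})) (- {b}) X (- {b}) id \<dots>
        = \<one>\<^bsub>relative_homology_group n X (- {b})\<^esub>"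
      by (rule hom_one[OF hom_induced_hom]) auto
    finally show ?thesis .
  qed
  have degree_0: "d = 0" if "has_degree g \<Omega> b d" for d
  proof -
    obtain R a c where R: "\<Omega> \<subseteq> cball 0 R" "b \<in> cball 0 R"
      and a: "a \<in> carrier (relative_homology_group n X (- cball 0 R))"
      and gen: "subgroup_generated (relative_homology_group n X (- cball 0 R)) {a} =
            relative_homology_group n X (- cball 0 R)"
      and c: "c \<in> carrier (relative_homology_group n Y (\<Omega> - Z))"
      and ca: "hom_induced n Y (\<Omega> - Z) X (- Z) id c = hom_induced n X (- cball 0 R) X (- Z) id a"
      and d: "hom_induced n Y (\<Omega> - Z) X (- {b}) g c =
            hom_induced n X (- cball 0 R) X (- {b}) id a [^]\<^bsub>relative_homology_group n X (- {b})\<^esub> d"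
      using \<open>has_degree g \<Omega> b d\<close> unfolding has_degree_def Let_def n_def X_def Y_def Z_def by blast
    interpret G: group "relative_homology_group n X (- cball 0 R)" by simp
    have hom: "hom_induced n X (- cball 0 R) X (- {b}) id \<in>
        hom (relative_homology_group n X (- cball 0 R)) (relative_homology_group n X (- {b}))"
      by (rule hom_induced_hom)
    have inj: "inj_on (hom_induced n X (- cball 0 R) X (- {b}) id)
        (carrier (relative_homology_group n X (- cball 0 R)))"
      unfolding X_def by (rule inj_on_hom_induced_cball_complement[OF R(2)])
    let ?h = "hom_induced n X (- cball 0 R) X (- {b}) id"
    have "?h (a [^]\<^bsub>relative_homology_group n X (- cball 0 R)\<^esub> d)
        = \<one>\<^bsub>relative_homology_group n X (- {b})\<^esub>"
      using hom_int_pow[OF hom a] d g_class[OF R(1) a c ca] by simp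
    also have "\<dots> = ?h \<one>\<^bsub>relative_homology_group n X (- cball 0 R)\<^esub>"
      using hom_one[OF hom] by simp
    finally have "a [^]\<^bsub>relative_homology_group n X (- cball 0 R)\<^esub> d
        = \<one>\<^bsub>relative_homology_group n X (- cball 0 R)\<^esub>"
      by (rule inj_onD[OF inj])
        (use a G.int_pow_closed[OF a, of d] in simp_all)
    \<comment> \<open>The group is generated by \<open>a\<close> and infinite, so a power of
      \<open>a\<close> is trivial only for exponent 0.\<close>
    moreover have "infinite (carrier (relative_homology_group n X (- cball 0 R)))"
    proof -
      have "0 \<le> R" using R(2) norm_ge_zero[of b] by (auto simp del: norm_ge_zero)
      then obtain h where "bij_betw h (carrier (relative_homology_group n X (- cball 0 R))) (UNIV :: int set)"
        using relative_homology_group_cball_complement[where 'a='a, of R]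
        unfolding is_iso_def iso_def n_def X_def by auto
      then show ?thesis
        using bij_betw_finite infinite_UNIV_int by blast
    qed
    ultimately show "d = 0"
      using G.finite_cyclic_subgroup_int[OF a] gen by metis
  qed
  have "has_degree g \<Omega> b 0"
  proof -
    \<comment> \<open>For existence, any ball containing \<open>\<Omega>\<close> and
      \<open>b\<close> serves; surjectivity of excision then yields \<open>c\<close>.\<close>
    obtain R where R: "insert b \<Omega> \<subseteq> cball 0 R"
      using \<open>bounded \<Omega>\<close> bounded_subset_ballD[of "insert b \<Omega>" 0] ball_subset_cball
      by (metis bounded_insert subset_trans)
    then have "0 \<le> R" by (metis insert_subset mem_cball_0 norm_ge_zero order_trans)
    then have "cyclic_group (relative_homology_group n X (- cball 0 R))"
      using isomorphic_group_cyclicity[OF relative_homology_group_cball_complement[where 'a='a, of R]]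
      by (simp add: n_def X_def)
    then obtain a where a: "a \<in> carrier (relative_homology_group n X (- cball 0 R))"
      and gen: "subgroup_generated (relative_homology_group n X (- cball 0 R)) {a} =
            relative_homology_group n X (- cball 0 R)"
      unfolding cyclic_group_def by blast
    have "hom_induced n X (- cball 0 R) X (- Z) id a
        \<in> hom_induced n Y (\<Omega> - Z) X (- Z) id ` carrier (relative_homology_group n Y (\<Omega> - Z))"
      using isoZ hom_induced_carrier[of n X "- cball 0 R" X "- Z" id a] by (simp add: iso_iff)
    then obtain c where ca: "hom_induced n X (- cball 0 R) X (- Z) id a = hom_induced n Y (\<Omega> - Z) X (- Z) id c"
      and c: "c \<in> carrier (relative_homology_group n Y (\<Omega> - Z))"
      by (rule imageE)
    have "hom_induced n Y (\<Omega> - Z) X (- {b}) g c =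
        hom_induced n X (- cball 0 R) X (- {b}) id a [^]\<^bsub>relative_homology_group n X (- {b})\<^esub> (0::int)"
      using g_class[OF _ a c ca[symmetric]] R by simp
    then show ?thesis
      using R a gen c ca[symmetric] unfolding has_degree_def Let_def n_def X_def Y_def Z_def by blast
  qed
  with degree_0 show ?thesis
    unfolding brouwer_degree_def by (intro the_equality)
qed

section \<open>Asymptotics of weakly homogeneous mappings\<close>

lemma weakly_homogeneous_on_continuous:
  "weakly_homogeneous_on D \<delta> \<phi> h \<Longrightarrow> continuous_on D \<phi>"
  unfolding weakly_homogeneous_on_def positively_homogeneous_on_def
  by (auto intro!: continuous_on_add elim: continuous_on_eq[rotated])

text \<open>Homogeneity turns the scaled leading term into \<open>h\<close> at the unit direction,
  where continuity applies; the scaled remainder tends to 0.\<close>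

lemma weakly_homogeneous_on_limit:
  fixes x :: "nat \<Rightarrow> 'a::real_normed_vector"
  assumes \<phi>: "weakly_homogeneous_on D \<delta> \<phi> h" and "closed D" "conic D"
    and x: "\<And>k. x k \<in> D" "\<And>k. x k \<noteq> 0" "filterlim (\<lambda>k. norm (x k)) at_top sequentially"
    and u: "(\<lambda>k. x k /\<^sub>R norm (x k)) \<longlonglongrightarrow> u"
  shows "u \<in> D" and "(\<lambda>k. \<phi> (x k) /\<^sub>R (norm (x k) powr \<delta>)) \<longlonglongrightarrow> h u"
proof -
  obtain e where h: "continuous_on D h" "\<And>x t. x \<in> D \<Longrightarrow> t > 0 \<Longrightarrow> h (t *\<^sub>R x) = (t powr \<delta>) *\<^sub>R h x"
    and \<phi>_eq: "\<And>x. x \<in> D \<Longrightarrow> \<phi> x = h x + e x"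
    and e: "((\<lambda>x. e x /\<^sub>R (norm x powr \<delta>)) \<longlongrightarrow> 0) (inf at_infinity (principal D))"
    using \<phi> unfolding weakly_homogeneous_on_def positively_homogeneous_on_def by auto
  have dir: "x k /\<^sub>R norm (x k) \<in> D" for k
    using \<open>conic D\<close> x(1) by (simp add: conic_def)
  show "u \<in> D"
    by (rule closed_sequentially[OF \<open>closed D\<close> dir u])
  have "filterlim x (inf at_infinity (principal D)) sequentially"
    using x(1,3) by (auto simp: filterlim_inf filterlim_principal filterlim_norm_at_top_imp_at_infinity)
  then have "(\<lambda>k. e (x k) /\<^sub>R (norm (x k) powr \<delta>)) \<longlonglongrightarrow> 0"
    by (rule filterlim_compose[OF e])
  moreover have "(\<lambda>k. h (x k /\<^sub>R norm (x k))) \<longlonglongrightarrow> h u"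
    using continuous_on_tendsto_compose[OF h(1) u \<open>u \<in> D\<close>] dir by auto
  ultimately have "(\<lambda>k. h (x k /\<^sub>R norm (x k)) + e (x k) /\<^sub>R (norm (x k) powr \<delta>)) \<longlonglongrightarrow> h u + 0"
    by (intro tendsto_add)
  moreover have "h (x k /\<^sub>R norm (x k)) + e (x k) /\<^sub>R (norm (x k) powr \<delta>)
      = \<phi> (x k) /\<^sub>R (norm (x k) powr \<delta>)" for k
  proof -
    have "h (x k) = (norm (x k) powr \<delta>) *\<^sub>R h (x k /\<^sub>R norm (x k))"
      using h(2)[OF dir[of k], of "norm (x k)"] x(2)[of k] by simp
    then show ?thesis
      using x(1,2)[of k] by (simp add: \<phi>_eq scaleR_add_right)
  qed
  ultimately show "(\<lambda>k. \<phi> (x k) /\<^sub>R (norm (x k) powr \<delta>)) \<longlonglongrightarrow> h u"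
    by simp
qed

lemma filterlim_powr_at_top:
  fixes p :: real
  assumes "0 < p"
  shows "filterlim (\<lambda>x. x powr p) at_top at_top"
proof -
  have "filterlim (\<lambda>x. exp (p * ln x)) at_top at_top"
    by (intro filterlim_compose[OF exp_at_top]
        filterlim_tendsto_pos_mult_at_top[OF tendsto_const assms] ln_at_top)
  moreover have "\<forall>\<^sub>F x in at_top. exp (p * ln x) = x powr p"
    using eventually_gt_at_top[of "0::real"] by eventually_elim (simp add: powr_def)
  ultimately show ?thesis
    by (simp add: filterlim_cong[OF refl refl])
qed

text \<open>A sequence violating the claim has a limit direction \<open>u\<close>. The violation
  forces \<open>f_inf u \<bullet> g_inf u\<close> to be at most 0 and monotonicity forces it to be
  at least 0, against \<open>nondeg\<close>.\<close>

lemma weakly_homogeneous_coercive: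
  fixes C K :: "'a::euclidean_space set"
  assumes C: "closed C" "convex_cone C"
    and f: "weakly_homogeneous_on C \<delta>\<^sub>1 f f_inf"
    and g: "weakly_homogeneous_on UNIV \<delta>\<^sub>2 g g_inf"
    and sub: "g -` K \<subseteq> C"
    and mono: "\<And>x. g x \<in> K \<Longrightarrow> 0 \<le> (f x - f \<theta>) \<bullet> (g x - g \<theta>)"
    and nondeg: "\<And>x. x \<in> C \<Longrightarrow> norm x = 1 \<Longrightarrow> g_inf x \<in> recession_cone K \<Longrightarrow> f_inf x \<bullet> g_inf x \<noteq> 0"
  obtains M where "\<And>x. g x \<in> K \<Longrightarrow> M \<le> norm x \<Longrightarrow> 0 < f x \<bullet> (g x - g \<theta>)"
proof (rule ccontr)
  assume "\<not> thesis"
  \<comment> \<open>The summand 1 makes every \<open>x k\<close> nonzero, including the one for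
    index 0.\<close>
  then have "\<forall>k::nat. \<exists>x. g x \<in> K \<and> real k + 1 \<le> norm x \<and> f x \<bullet> (g x - g \<theta>) \<le> 0"
    using that by (meson not_le)
  from choice[OF this]
  obtain x where x: "\<And>k. g (x k) \<in> K" "\<And>k. real k + 1 \<le> norm (x k)"
    "\<And>k. f (x k) \<bullet> (g (x k) - g \<theta>) \<le> 0"
    by blast
  have nz: "x k \<noteq> 0" for k using x(2)[of k] by auto
  define w where "w = (\<lambda>k. x k /\<^sub>R norm (x k))"
  have "\<forall>k. w k \<in> sphere 0 1" using nz by (simp add: w_def)
  then obtain u \<sigma> where "u \<in> sphere 0 1" and \<sigma>: "strict_mono (\<sigma> :: nat \<Rightarrow> nat)"
    and u: "(w \<circ> \<sigma>) \<longlonglongrightarrow> u"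
    using compact_sphere[of "0::'a" 1] unfolding compact_def by blast
  define y where "y = x \<circ> \<sigma>"
  have y: "g (y k) \<in> K" "y k \<in> C" "y k \<noteq> 0" "f (y k) \<bullet> (g (y k) - g \<theta>) \<le> 0" for k
    using x nz sub by (auto simp: y_def)
  have norm_y: "filterlim (\<lambda>k. norm (y k)) at_top sequentially"
  proof (rule filterlim_at_top_mono[OF filterlim_real_sequentially])
    have "real k \<le> norm (y k)" for k
      using x(2)[of "\<sigma> k"] seq_suble[OF \<sigma>, of k] by (simp add: y_def)
    then show "\<forall>\<^sub>F k in sequentially. real k \<le> norm (y k)" by simp
  qed
  define p where "p = (\<lambda>k. norm (y k) powr \<delta>\<^sub>1)"
  define q where "q = (\<lambda>k. norm (y k) powr \<delta>\<^sub>2)"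
  have pos: "0 < p k" "0 < q k" for k
    using y(3) by (auto simp: p_def q_def)
  have "0 < \<delta>\<^sub>1" "0 < \<delta>\<^sub>2"
    using f g by (auto simp: weakly_homogeneous_on_def)
  then have p_top: "filterlim p at_top sequentially" and q_top: "filterlim q at_top sequentially"
    unfolding p_def q_def by (auto intro: filterlim_compose[OF filterlim_powr_at_top norm_y])
  have small: "(\<lambda>k. v /\<^sub>R p k) \<longlonglongrightarrow> 0" "(\<lambda>k. v /\<^sub>R q k) \<longlonglongrightarrow> 0" for v :: 'a
    using tendsto_scaleR[OF tendsto_inverse_0_at_top[OF p_top] tendsto_const[of v]]
      tendsto_scaleR[OF tendsto_inverse_0_at_top[OF q_top] tendsto_const[of v]] by auto
  have u': "(\<lambda>k. y k /\<^sub>R norm (y k)) \<longlonglongrightarrow> u"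
    using u by (simp add: w_def y_def o_def)
  have "u \<in> C" and f_lim: "(\<lambda>k. f (y k) /\<^sub>R p k) \<longlonglongrightarrow> f_inf u"
    unfolding p_def using weakly_homogeneous_on_limit[OF f C(1) _ y(2,3) norm_y u'] C(2)
    by (auto simp: convex_cone_def)
  have g_lim: "(\<lambda>k. g (y k) /\<^sub>R q k) \<longlonglongrightarrow> g_inf u"
    unfolding q_def using weakly_homogeneous_on_limit(2)[OF g _ _ _ y(3) norm_y u']
    by (auto simp: conic_def)
  \<comment> \<open>The scales \<open>q\<close> and the points \<open>g (y k)\<close> of
    \<open>K\<close> are the witnesses required by the recession cone.\<close>
  have "g_inf u \<in> recession_cone K"
    unfolding recession_cone_def using q_top g_lim y(1) by (auto intro!: exI[of _ q] exI[of _ "\<lambda>k. g (y k)"])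
  then have ne: "f_inf u \<bullet> g_inf u \<noteq> 0"
    using nondeg \<open>u \<in> C\<close> \<open>u \<in> sphere 0 1\<close> by simp
  have diff_lim: "(\<lambda>k. (g (y k) - g \<theta>) /\<^sub>R q k) \<longlonglongrightarrow> g_inf u"
    using tendsto_diff[OF g_lim small(2)[of "g \<theta>"]] by (simp add: scaleR_diff_right)
  have "f_inf u \<bullet> g_inf u \<le> 0"
  proof (rule tendsto_upperbound[OF tendsto_inner[OF f_lim diff_lim]])
    show "\<forall>\<^sub>F k in sequentially. (f (y k) /\<^sub>R p k) \<bullet> ((g (y k) - g \<theta>) /\<^sub>R q k) \<le> 0"
      using y(4) pos by (simp add: mult_nonneg_nonpos less_imp_le)
  qed simp
  \<comment> \<open>The left side is the limit of the terms with the fixed vector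
    \<open>f \<theta>\<close>, which vanishes after division by \<open>p k\<close>.\<close>
  moreover have "0 \<bullet> g_inf u \<le> f_inf u \<bullet> g_inf u"
  proof (rule tendsto_le[OF _ tendsto_inner[OF f_lim diff_lim] tendsto_inner[OF small(1)[of "f \<theta>"] diff_lim]])
    have "f \<theta> \<bullet> (g (y k) - g \<theta>) \<le> f (y k) \<bullet> (g (y k) - g \<theta>)" for k
      using mono[OF y(1), of k] by (simp add: inner_diff_left)
    then show "\<forall>\<^sub>F k in sequentially. (f \<theta> /\<^sub>R p k) \<bullet> ((g (y k) - g \<theta>) /\<^sub>R q k)
        \<le> (f (y k) /\<^sub>R p k) \<bullet> ((g (y k) - g \<theta>) /\<^sub>R q k)"
      using pos by (simp add: mult_left_mono less_imp_le)
  qed simp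
  ultimately show False
    using ne by simp
qed

section \<open>Compactness and existence of solutions\<close>

theorem mainTheorem5:
  fixes C K :: "'a::euclidean_space set"
    and f g f_inf g_inf :: "'a \<Rightarrow> 'a"
    and \<delta>\<^sub>1 \<delta>\<^sub>2 :: real
  assumes C: "closed C" "convex_cone C"
    and K: "K \<noteq> {}" "closed K" "convex K"
    and f: "weakly_homogeneous_on C \<delta>\<^sub>1 f f_inf"
    and g: "weakly_homogeneous_on UNIV \<delta>\<^sub>2 g g_inf"
    and sub: "g -` K \<subseteq> C"
    and deg: "\<And>xhat r. r > norm (closest_point K xhat) \<Longrightarrow>
        degree_defined g {x. norm (g x) < r} (closest_point K xhat) \<and>
        brouwer_degree g {x. norm (g x) < r} (closest_point K xhat) \<noteq> 0"
    and i: "\<exists>\<theta>. g \<theta> \<in> K \<and> (\<forall>x. g x \<in> K \<longrightarrow> 0 \<le> (f x - f \<theta>) \<bullet> (g x - g \<theta>))"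
    and ii: "\<forall>x\<in>C. norm x = 1 \<and> g_inf x \<in> recession_cone K \<longrightarrow> f_inf x \<bullet> g_inf x \<noteq> 0"
  shows "GVI_SOL f g K \<noteq> {} \<and> compact (GVI_SOL f g K)"
proof -
  obtain \<theta> where \<theta>: "g \<theta> \<in> K" and mono: "\<And>x. g x \<in> K \<Longrightarrow> 0 \<le> (f x - f \<theta>) \<bullet> (g x - g \<theta>)"
    using i by auto
  obtain M where M: "\<And>x. g x \<in> K \<Longrightarrow> M \<le> norm x \<Longrightarrow> 0 < f x \<bullet> (g x - g \<theta>)"
    using weakly_homogeneous_coercive[OF C f g sub mono] ii by blast
  have cont_f: "continuous_on C f" and cont_g: "continuous_on UNIV g"
    using weakly_homogeneous_on_continuous f g by blast+
  have "bounded (GVI_SOL f g K)"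
  proof (rule boundedI)
    fix x assume "x \<in> GVI_SOL f g K"
    then have x: "g x \<in> K" "0 \<le> f x \<bullet> (g \<theta> - g x)"
      using \<theta> by (auto simp: GVI_SOL_def)
    then have "\<not> 0 < f x \<bullet> (g x - g \<theta>)"
      by (simp add: inner_diff_right)
    then show "norm x \<le> M"
      using M x(1) by force
  qed
  moreover have "closed (GVI_SOL f g K)"
  proof -
    have closed: "closed (g -` K)"
      using continuous_closed_preimage[OF cont_g closed_UNIV K(2)] by simp
    have "closed (g -` K \<inter> (\<lambda>x. f x \<bullet> (y - g x)) -` {0..})" for y
      by (intro continuous_closed_preimage closed continuous_intros
          continuous_on_subset[OF cont_f sub] continuous_on_subset[OF cont_g]) auto
    then have "closed (\<Inter>y\<in>K. g -` K \<inter> (\<lambda>x. f x \<bullet> (y - g x)) -` {0..})"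
      by blast
    also have "(\<Inter>y\<in>K. g -` K \<inter> (\<lambda>x. f x \<bullet> (y - g x)) -` {0..}) = GVI_SOL f g K"
      using K(1) by (auto simp: GVI_SOL_def)
    finally show ?thesis .
  qed
  moreover have "GVI_SOL f g K \<noteq> {}"
  proof
    assume empty: "GVI_SOL f g K = {}"
    \<comment> \<open>Taking \<open>g \<theta>\<close> itself as the projected point makes the
      degree hypothesis available at the value \<open>g \<theta>\<close>.\<close>
    have proj: "closest_point K (g \<theta>) = g \<theta>"
      using \<theta> by (rule closest_point_self)
    have "bounded (g ` cball 0 M)"
      by (intro compact_imp_bounded compact_continuous_image continuous_on_subset[OF cont_g]) auto
    then obtain B where B: "\<And>x. norm x \<le> M \<Longrightarrow> norm (g x) \<le> B"
      unfolding bounded_iff by (metis image_eqI mem_cball_0)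
    \<comment> \<open>Exceeding \<open>B\<close> puts every \<open>x\<close> outside
      \<open>\<Omega>\<close> in the range \<open>M \<le> norm x\<close>; exceeding
      \<open>norm (g \<theta>)\<close> is what \<open>deg\<close> demands.\<close>
    define r where "r = max B (norm (g \<theta>)) + 1"
    define \<Omega> where "\<Omega> = {x. norm (g x) < r}"
    have "norm (g \<theta>) < r" by (simp add: r_def)
    then have defined: "degree_defined g \<Omega> (g \<theta>)" and nz: "brouwer_degree g \<Omega> (g \<theta>) \<noteq> 0"
      using deg[of "g \<theta>" r] by (auto simp: proj \<Omega>_def)
    \<comment> \<open>Projecting the argument of \<open>f\<close> onto \<open>C\<close> makes
      \<open>z\<close> continuous everywhere. Nothing changes where \<open>g x\<close> lies in
      \<open>K\<close>, since there \<open>x\<close> is in \<open>C\<close>.\<close>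
    define z where "z = (\<lambda>(t, x). t *\<^sub>R (g x - f (closest_point C x)) + (1 - t) *\<^sub>R g \<theta>)"
    \<comment> \<open>Adding \<open>g \<theta>\<close> makes the homotopy start at \<open>g\<close>
      itself and moves the target value from 0 to \<open>g \<theta>\<close>.\<close>
    define H where "H = (\<lambda>(t, x). g x - closest_point K (z (t, x)) + g \<theta>)"
    have "C \<noteq> {}" "convex C" using C(2) by (auto simp: convex_cone_def)
    have cont_z: "continuous_on UNIV z"
      unfolding z_def case_prod_unfold
      by (intro continuous_intros continuous_on_compose2[OF cont_f] continuous_on_compose2[OF cont_g]
          continuous_on_compose2[OF continuous_on_closest_point[OF \<open>convex C\<close> C(1) \<open>C \<noteq> {}\<close>, of UNIV]])
        (auto intro: closest_point_in_set[OF C(1) \<open>C \<noteq> {}\<close>])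
    have cont_H: "continuous_on ({0..1} \<times> closure \<Omega>) H"
      unfolding H_def case_prod_unfold prod.collapse
      by (intro continuous_intros continuous_on_compose2[OF cont_g] continuous_on_compose2[OF cont_z]
          continuous_on_compose2[OF continuous_on_closest_point[OF K(3,2,1), of UNIV]]) auto
    \<comment> \<open>The equation says that \<open>g x\<close> is the projection of
      \<open>z (t, x)\<close> onto \<open>K\<close>, so the obtuse angle criterion applies. With
      \<open>t = 1\<close> it is the inequality defining a solution.\<close>
    have zero: "g x \<in> K \<and> (\<forall>y\<in>K. (t *\<^sub>R (g x - f x) + (1 - t) *\<^sub>R g \<theta> - g x) \<bullet> (y - g x) \<le> 0)"
      if "H (t, x) = g \<theta>" for t x
    proof -
      have gx: "g x = closest_point K (z (t, x))"
        using that by (simp add: H_def)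
      then have "g x \<in> K" using closest_point_in_set K by metis
      then have "closest_point C x = x"
        using sub by (intro closest_point_self) auto
      then have z: "z (t, x) = t *\<^sub>R (g x - f x) + (1 - t) *\<^sub>R g \<theta>"
        by (simp add: z_def)
      have "\<forall>y\<in>K. (z (t, x) - g x) \<bullet> (y - g x) \<le> 0"
        unfolding gx by (intro ballI closest_point_dot K)
      with \<open>g x \<in> K\<close> show ?thesis
        unfolding z by blast
    qed
    have "brouwer_degree g \<Omega> (g \<theta>) = 0"
    proof (rule brouwer_degree_eq_0_homotopy[OF defined cont_H])
      show "H (0, x) = g x" for x
        by (simp add: H_def z_def proj)
      show "H (1, x) \<noteq> g \<theta>" for x
      proof
        assume "H (1, x) = g \<theta>"
        from zero[OF this] have "x \<in> GVI_SOL f g K"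
          by (simp add: GVI_SOL_def)
        with empty show False by simp
      qed
      show "H (t, x) \<noteq> g \<theta>" if t: "t \<in> {0..1}" and x: "x \<in> frontier \<Omega>" for t x
      proof
        assume "H (t, x) = g \<theta>"
        then have "g x \<in> K"
          and dot: "(t *\<^sub>R (g x - f x) + (1 - t) *\<^sub>R g \<theta> - g x) \<bullet> (g \<theta> - g x) \<le> 0"
          using zero \<theta> by blast+
        have "x \<notin> \<Omega>"
          using x defined by (auto simp: frontier_def interior_open degree_defined_def)
        then have "M \<le> norm x"
          using B[of x] by (force simp: \<Omega>_def r_def)
        then have pos: "0 < f x \<bullet> (g x - g \<theta>)"
          using M \<open>g x \<in> K\<close> by blast
        then have pos': "0 < (g x - g \<theta>) \<bullet> (g x - g \<theta>)"
          by auto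
        \<comment> \<open>Testing with \<open>y = g \<theta>\<close> gives a convex combination of
          two positive numbers, which cannot be at most 0.\<close>
        have "(t *\<^sub>R (g x - f x) + (1 - t) *\<^sub>R g \<theta> - g x) \<bullet> (g \<theta> - g x)
            = t * (f x \<bullet> (g x - g \<theta>)) + (1 - t) * ((g x - g \<theta>) \<bullet> (g x - g \<theta>))"
          by (simp add: inner_simps inner_commute algebra_simps)
        moreover have "0 < \<dots>"
          using t pos pos' by (cases "t = 0") (auto intro: add_pos_nonneg)
        ultimately show False using dot by simp
      qed
    qed
    with nz show False by simp
  qed
  ultimately show ?thesis
    by (simp add: compact_eq_bounded_closed)
qed

end
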